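(* Let $p>2$. There exist a finite dyadic tree $T$ and functions $f,g:T\to[0,\infty)$, with $g$ superadditive (in particular increasing) and with $\max_T II^*g$ attained at some leaf $\omega$ of $T$ with $\omega\in\operatorname{supp} g$, such that the inequality $$\sum_{T}(If)^p\,g\le\Bigl(\sup_{\operatorname{supp} g\,\cap\,\operatorname{supp} f}II^*g\Bigr)\sum_T f^p$$ fails.
   Context: A finite dyadic tree $T$ is the set of dyadic subintervals of $[0,1]$ of the first finitely many generations (generations $0,\dots,N$), ordered by inclusion: $\alpha\le\beta$ iff $\alpha\subseteq\beta$; the children of a non-leaf $\beta$ are its two dyadic halves, and the leaves (the boundary $\partial T$) are the minimal elements. For $h:T\to[0,\infty)$ put $Ih(\alpha)=\sum_{\alpha'\ge\alpha}h(\alpha')$ and $I^*h(\alpha)=\sum_{\alpha'\le\alpha}h(\alpha')$. A function $g:T\to[0,\infty)$ is superadditive if $g(\beta)\ge\sum_{\beta'\in\mathrm{ch}(\beta)}g(\beta')$ for every $\beta\in T$, where $\mathrm{ch}(\beta)$ is the set of children of $\beta$ (empty for a leaf); it is increasing if $\alpha\le\beta$ implies $g(\alpha)\le g(\beta)$. *)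

theory Defs
  imports Complex_Main
begin

definition dyadic_interval :: "nat \<Rightarrow> nat \<Rightarrow> real set" where
  "dyadic_interval n k = {real k / 2 ^ n .. (real k + 1) / 2 ^ n}"

text \<open>Dyadic subintervals of \<open>[0,1]\<close> of generations \<open>0, \<dots>, N\<close>, ordered by inclusion.
  Functions on the tree are total functions on \<open>real set\<close>; only their values on the tree are used.\<close>

definition dyadic_tree :: "nat \<Rightarrow> real set set" where
  "dyadic_tree N = {dyadic_interval n k | n k. n \<le> N \<and> k < 2 ^ n}"

lemma finite_dyadic_tree: "finite (dyadic_tree N)"
proof -
  have "dyadic_tree N \<subseteq> (\<lambda>(n, k). dyadic_interval n k) ` (SIGMA n:{..N}. {..<2 ^ n})"
    unfolding dyadic_tree_def by force
  then show ?thesis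
    by (rule finite_subset) auto
qed

definition leaves :: "real set set \<Rightarrow> real set set" where
  "leaves T = {\<alpha> \<in> T. \<forall>\<beta>\<in>T. \<beta> \<subseteq> \<alpha> \<longrightarrow> \<beta> = \<alpha>}"

definition children :: "real set set \<Rightarrow> real set \<Rightarrow> real set set" where
  "children T \<beta> = {\<alpha> \<in> T. \<exists>a b. a < b \<and> \<beta> = {a..b} \<and>
     (\<alpha> = {a..(a + b) / 2} \<or> \<alpha> = {(a + b) / 2..b})}"

definition hardy :: "real set set \<Rightarrow> (real set \<Rightarrow> real) \<Rightarrow> real set \<Rightarrow> real" where
  "hardy T h \<alpha> = (\<Sum>\<alpha>' \<in> {\<alpha>' \<in> T. \<alpha> \<subseteq> \<alpha>'}. h \<alpha>')"

definition hardy_adj :: "real set set \<Rightarrow> (real set \<Rightarrow> real) \<Rightarrow> real set \<Rightarrow> real" where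
  "hardy_adj T h \<alpha> = (\<Sum>\<alpha>' \<in> {\<alpha>' \<in> T. \<alpha>' \<subseteq> \<alpha>}. h \<alpha>')"

definition supp_on :: "real set set \<Rightarrow> (real set \<Rightarrow> real) \<Rightarrow> real set set" where
  "supp_on T h = {\<alpha> \<in> T. h \<alpha> \<noteq> 0}"

definition superadditive :: "real set set \<Rightarrow> (real set \<Rightarrow> real) \<Rightarrow> bool" where
  "superadditive T g \<longleftrightarrow> (\<forall>\<beta>\<in>T. (\<Sum>\<beta>' \<in> children T \<beta>. g \<beta>') \<le> g \<beta>)"

definition tree_increasing :: "real set set \<Rightarrow> (real set \<Rightarrow> real) \<Rightarrow> bool" where
  "tree_increasing T g \<longleftrightarrow> (\<forall>\<alpha>\<in>T. \<forall>\<beta>\<in>T. \<alpha> \<subseteq> \<beta> \<longrightarrow> g \<alpha> \<le> g \<beta>)"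

end

(* Take g = 1 on the N + 1 intervals containing 0, and f = 1 on the two largest of them. Then I f
   equals 2 at all but the first vertex of this branch, so the left side is 1 + 2^p N. On supp f,
   II*g is at most (N + 1) + N, so the right side is at most 2 (2N + 1). As 2^p > 4, the left side
   is larger once N is large. *)

theory Submission
  imports Defs
begin

lemma dyadic_interval_zero: "dyadic_interval n 0 = {0..1 / 2 ^ n}"
  by (simp add: dyadic_interval_def)

lemma dyadic_interval_zero_subset_iff:
  "dyadic_interval m 0 \<subseteq> dyadic_interval n 0 \<longleftrightarrow> n \<le> m"
  by (simp add: dyadic_interval_zero field_simps)

lemma half_subset_dyadic_interval_zero_iff: "{0..1/2} \<subseteq> dyadic_interval n 0 \<longleftrightarrow> n \<le> 1"
  using dyadic_interval_zero_subset_iff[of 1 n] by (simp add: dyadic_interval_zero[of "Suc 0"])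

lemma inj_dyadic_interval_zero: "inj (\<lambda>n. dyadic_interval n 0)"
  by (rule injI) (metis dyadic_interval_zero_subset_iff order_refl order_antisym)

lemma dyadic_interval_zero_in_tree: "n \<le> N \<Longrightarrow> dyadic_interval n 0 \<in> dyadic_tree N"
  by (force simp: dyadic_tree_def)

lemma zero_in_dyadic_interval_iff: "0 \<in> dyadic_interval n k \<longleftrightarrow> k = 0"
  by (auto simp: dyadic_interval_def field_simps)

lemma dyadic_tree_containing_zero:
  "{\<alpha> \<in> dyadic_tree N. 0 \<in> \<alpha>} = (\<lambda>n. dyadic_interval n 0) ` {..N}"
proof
  show "{\<alpha> \<in> dyadic_tree N. 0 \<in> \<alpha>} \<subseteq> (\<lambda>n. dyadic_interval n 0) ` {..N}"
    by (auto simp: dyadic_tree_def zero_in_dyadic_interval_iff)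
  show "(\<lambda>n. dyadic_interval n 0) ` {..N} \<subseteq> {\<alpha> \<in> dyadic_tree N. 0 \<in> \<alpha>}"
    by (auto simp: dyadic_interval_zero_in_tree zero_in_dyadic_interval_iff)
qed

text \<open>The vertices containing 0 form a single branch with one vertex per generation, so a sum
  over the tree of a function vanishing off this branch becomes a sum over generations. The
  predicate \<open>P\<close> lets one lemma serve the sums over ancestors, over descendants and over
  the whole tree.\<close>

lemma sum_dyadic_tree_supported_at_zero:
  fixes h :: "real set \<Rightarrow> real"
  assumes "\<And>\<alpha>. \<alpha> \<in> dyadic_tree N \<Longrightarrow> 0 \<notin> \<alpha> \<Longrightarrow> h \<alpha> = 0"
  shows "(\<Sum>\<alpha> \<in> {\<alpha> \<in> dyadic_tree N. P \<alpha>}. h \<alpha>)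
    = (\<Sum>n \<in> {n. n \<le> N \<and> P (dyadic_interval n 0)}. h (dyadic_interval n 0))"
proof -
  have "{\<alpha> \<in> dyadic_tree N. 0 \<in> \<alpha> \<and> P \<alpha>} = {\<alpha> \<in> {\<alpha> \<in> dyadic_tree N. 0 \<in> \<alpha>}. P \<alpha>}"
    by simp
  also have "\<dots> = (\<lambda>n. dyadic_interval n 0) ` {n. n \<le> N \<and> P (dyadic_interval n 0)}"
    unfolding dyadic_tree_containing_zero by auto
  finally have eq: "{\<alpha> \<in> dyadic_tree N. 0 \<in> \<alpha> \<and> P \<alpha>}
      = (\<lambda>n. dyadic_interval n 0) ` {n. n \<le> N \<and> P (dyadic_interval n 0)}" .
  have "(\<Sum>\<alpha> \<in> {\<alpha> \<in> dyadic_tree N. P \<alpha>}. h \<alpha>)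
      = (\<Sum>\<alpha> \<in> {\<alpha> \<in> dyadic_tree N. 0 \<in> \<alpha> \<and> P \<alpha>}. h \<alpha>)"
    by (rule sum.mono_neutral_right) (use finite_dyadic_tree assms in auto)
  then show ?thesis
    unfolding eq
    by (simp add: sum.reindex inj_on_subset[OF inj_dyadic_interval_zero])
qed

lemma dyadic_interval_zero_in_leaves: "dyadic_interval N 0 \<in> leaves (dyadic_tree N)"
proof -
  have "\<beta> = dyadic_interval N 0" if "\<beta> \<in> dyadic_tree N" "\<beta> \<subseteq> dyadic_interval N 0" for \<beta>
  proof -
    obtain n k where nk: "\<beta> = dyadic_interval n k" "n \<le> N"
      using \<open>\<beta> \<in> dyadic_tree N\<close> by (auto simp: dyadic_tree_def)
    \<comment> \<open>Comparing right endpoints forces \<open>k = 0\<close>, which puts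
      \<open>\<beta>\<close> on the branch, where inclusion is decided by generation.\<close>
    have "(real k + 1) / 2 ^ n \<le> 1 / 2 ^ N"
      using that(2) by (simp add: nk dyadic_interval_def divide_right_mono)
    also have "\<dots> \<le> 1 / 2 ^ n"
      using nk(2) by (simp add: field_simps)
    finally have "k = 0"
      by (simp add: divide_le_cancel)
    with that(2) nk show ?thesis
      by (simp add: dyadic_interval_zero_subset_iff)
  qed
  then show ?thesis
    by (auto simp: leaves_def dyadic_interval_zero_in_tree)
qed

text \<open>If 0 lies in a dyadic interval, it is the left endpoint, so the right half starts at a
  positive midpoint and misses 0. Writing the left half through \<open>Sup \<beta>\<close> makes it
  depend on \<open>\<beta>\<close> alone, so at most one child contains 0.\<close>

lemma child_containing_zero:
  assumes "\<beta> \<in> dyadic_tree N" "\<alpha> \<in> children (dyadic_tree N) \<beta>" "0 \<in> \<alpha>"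
  shows "0 \<in> \<beta>" and "\<alpha> = {0..Sup \<beta> / 2}"
proof -
  obtain n k where \<beta>: "\<beta> = dyadic_interval n k"
    using assms(1) by (auto simp: dyadic_tree_def)
  obtain a b where ab: "a < b" "\<beta> = {a..b}" "\<alpha> = {a..(a + b) / 2} \<or> \<alpha> = {(a + b) / 2..b}"
    using assms(2) by (auto simp: children_def)
  show "0 \<in> \<beta>"
    using ab assms(3) by auto
  then have "\<beta> = {0..1 / 2 ^ n}"
    using \<beta> by (simp add: zero_in_dyadic_interval_iff dyadic_interval_zero)
  then have "a = 0"
    using ab(1,2) by (simp add: Icc_eq_Icc)
  then show "\<alpha> = {0..Sup \<beta> / 2}"
    using ab assms(3) by auto
qed

text \<open>The sum over the children counts those containing 0: at most one in general, and none
  when the parent misses 0.\<close>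

lemma superadditive_of_bool_zero: "superadditive (dyadic_tree N) (\<lambda>\<alpha>. of_bool (0 \<in> \<alpha>))"
  unfolding superadditive_def
proof
  fix \<beta> assume \<beta>: "\<beta> \<in> dyadic_tree N"
  let ?C = "children (dyadic_tree N) \<beta>"
  have "finite ?C"
    by (rule finite_subset[OF _ finite_dyadic_tree[of N]]) (auto simp: children_def)
  then have "(\<Sum>\<alpha>\<in>?C. of_bool (0 \<in> \<alpha>)) = real (card {\<alpha> \<in> ?C. 0 \<in> \<alpha>})"
    by (simp add: Int_def)
  also have "\<dots> \<le> of_bool (0 \<in> \<beta>)"
  proof (cases "0 \<in> \<beta>")
    case True
    have "{\<alpha> \<in> ?C. 0 \<in> \<alpha>} \<subseteq> {{0..Sup \<beta> / 2}}"
      using child_containing_zero(2)[OF \<beta>] by blast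
    then have "card {\<alpha> \<in> ?C. 0 \<in> \<alpha>} \<le> card {{0..Sup \<beta> / 2}}"
      by (rule card_mono[rotated]) simp
    with True show ?thesis by simp
  next
    case False
    then have "{\<alpha> \<in> ?C. 0 \<in> \<alpha>} = {}"
      using child_containing_zero(1)[OF \<beta>] by blast
    then show ?thesis by (simp only: card.empty of_nat_0 of_bool_def) simp
  qed
  finally show "(\<Sum>\<alpha>\<in>?C. of_bool (0 \<in> \<alpha>)) \<le> (of_bool (0 \<in> \<beta>) :: real)" .
qed

lemma hardy_adj_of_bool_zero:
  assumes "m \<le> N"
  shows "hardy_adj (dyadic_tree N) (\<lambda>\<alpha>. of_bool (0 \<in> \<alpha>)) (dyadic_interval m 0) = real (N + 1 - m)"
proof -
  have "{n. n \<le> N \<and> m \<le> n} = {m..N}" by auto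
  then show ?thesis
    by (simp add: hardy_adj_def sum_dyadic_tree_supported_at_zero
        zero_in_dyadic_interval_iff dyadic_interval_zero_subset_iff)
qed

text \<open>Subsets of a set missing 0 miss 0 as well. Hence \<open>hardy_adj\<close> of the
  indicator again lives on the branch, and the reduction to generations applies a second
  time.\<close>

lemma hardy_adj_of_bool_zero_eq_0:
  assumes "0 \<notin> \<alpha>"
  shows "hardy_adj T (\<lambda>\<alpha>. of_bool (0 \<in> \<alpha>)) \<alpha> = 0"
  unfolding hardy_adj_def using assms by (intro sum.neutral) auto

lemma hardy_hardy_adj_of_bool_zero:
  "hardy (dyadic_tree N) (hardy_adj (dyadic_tree N) (\<lambda>\<alpha>. of_bool (0 \<in> \<alpha>))) \<alpha>
    = (\<Sum>n \<in> {n. n \<le> N \<and> \<alpha> \<subseteq> dyadic_interval n 0}. real (N + 1 - n))"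
  by (simp add: hardy_def sum_dyadic_tree_supported_at_zero hardy_adj_of_bool_zero_eq_0
      hardy_adj_of_bool_zero)

text \<open>Only generations 0 and 1 contribute; the root sees just itself, every later vertex of
  the branch sees both. The bound on \<open>N\<close> ensures that generation 1 belongs to the
  tree.\<close>

lemma hardy_of_bool_half:
  assumes "N \<ge> 1"
  shows "hardy (dyadic_tree N) (\<lambda>\<alpha>. of_bool ({0..1/2} \<subseteq> \<alpha>)) (dyadic_interval m 0)
    = (if m = 0 then 1 else 2)"
proof -
  have "hardy (dyadic_tree N) (\<lambda>\<alpha>. of_bool ({0..1/2} \<subseteq> \<alpha>)) (dyadic_interval m 0)
    = (\<Sum>n \<in> {n. n \<le> N \<and> n \<le> m}. of_bool (n \<le> 1))"
    unfolding hardy_def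
    by (subst sum_dyadic_tree_supported_at_zero)
      (auto simp: half_subset_dyadic_interval_zero_iff dyadic_interval_zero_subset_iff
        dest: subsetD[of _ _ 0])
  also have "\<dots> = real (card {n. n \<le> N \<and> n \<le> m \<and> n \<le> 1})"
    by (simp add: Int_def conj_assoc)
  also have "{n. n \<le> N \<and> n \<le> m \<and> n \<le> 1} = (if m = 0 then {0} else {0, 1})"
    using assms by auto
  finally show ?thesis by simp
qed

theorem mainTheorem3:
  fixes p :: real
  assumes "p > 2"
  shows "\<exists>(N::nat) (f :: real set \<Rightarrow> real) (g :: real set \<Rightarrow> real) T.
           T = dyadic_tree N \<and>
           (\<forall>\<alpha>\<in>T. 0 \<le> f \<alpha>) \<and> (\<forall>\<alpha>\<in>T. 0 \<le> g \<alpha>) \<and>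
           superadditive T g \<and> tree_increasing T g \<and>
           (\<exists>\<omega>\<in>leaves T. \<omega> \<in> supp_on T g \<and>
              (\<forall>\<alpha>\<in>T. hardy T (hardy_adj T g) \<alpha> \<le> hardy T (hardy_adj T g) \<omega>)) \<and>
           supp_on T g \<inter> supp_on T f \<noteq> {} \<and>
           \<not> (\<Sum>\<alpha>\<in>T. (hardy T f \<alpha>) powr p * g \<alpha>)
               \<le> (SUP \<alpha>\<in>supp_on T g \<inter> supp_on T f. hardy T (hardy_adj T g) \<alpha>)
                  * (\<Sum>\<alpha>\<in>T. f \<alpha> powr p)"
proof -
  \<comment> \<open>Here \<open>p > 2\<close> enters: as functions of \<open>N\<close>, the left
    side grows with slope \<open>2 powr p\<close> and the bound for the right side with slope
    4.\<close>
  have "2 powr 2 < 2 powr p"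
    using assms by (intro powr_less_mono) auto
  then have p4: "2 powr p - 4 > 0" by simp
  \<comment> \<open>This is \<open>4 * N + 2 < 1 + N * 2 powr p\<close> solved for \<open>N\<close>.
    Passing to \<open>Suc M\<close> also secures \<open>N \<ge> 1\<close>.\<close>
  obtain M where M: "1 / (2 powr p - 4) < real M"
    using reals_Archimedean2 by blast
  define N where "N = Suc M"
  have N1: "N \<ge> 1" by (simp add: N_def)
  have "1 / (2 powr p - 4) < real N"
    using M by (simp add: N_def)
  then have N: "4 * real N + 2 < 1 + real N * 2 powr p"
    using p4 by (simp add: field_simps)
  define T where "T = dyadic_tree N"
  define f :: "real set \<Rightarrow> real" where "f = (\<lambda>\<alpha>. of_bool ({0..1/2} \<subseteq> \<alpha>))"
  define g :: "real set \<Rightarrow> real" where "g = (\<lambda>\<alpha>. of_bool (0 \<in> \<alpha>))"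
  define J where "J = (\<lambda>n. dyadic_interval n 0)"
  have II: "hardy T (hardy_adj T g) \<alpha> = (\<Sum>n \<in> {n. n \<le> N \<and> \<alpha> \<subseteq> J n}. real (N + 1 - n))" for \<alpha>
    unfolding T_def g_def J_def by (rule hardy_hardy_adj_of_bool_zero)
  have fJ: "f (J n) = of_bool (n \<le> 1)" for n
    by (simp add: f_def J_def half_subset_dyadic_interval_zero_iff)
  have f0: "f \<alpha> = 0" if "0 \<notin> \<alpha>" for \<alpha>
    using that by (auto simp: f_def dest: subsetD[of _ _ 0])
  have gJ: "g (J n) = 1" for n
    by (simp add: g_def J_def zero_in_dyadic_interval_iff)
  have sumT: "(\<Sum>\<alpha>\<in>T. h \<alpha>) = (\<Sum>n\<le>N. h (J n))" if "\<And>\<alpha>. 0 \<notin> \<alpha> \<Longrightarrow> h \<alpha> = 0"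
    for h :: "real set \<Rightarrow> real"
    using sum_dyadic_tree_supported_at_zero[of N h "\<lambda>_. True"] that
    by (simp add: T_def J_def atMost_def)
  have lhs: "(\<Sum>\<alpha>\<in>T. (hardy T f \<alpha>) powr p * g \<alpha>) = 1 + real N * 2 powr p"
  proof -
    have "hardy T f (J n) = (if n = 0 then 1 else 2)" for n
      using hardy_of_bool_half[OF N1] by (simp add: f_def J_def T_def)
    then have "(\<Sum>\<alpha>\<in>T. (hardy T f \<alpha>) powr p * g \<alpha>)
        = (\<Sum>n\<in>{..N}. (if n = 0 then 1 else 2) powr p)"
      by (subst sumT) (simp_all add: g_def gJ[unfolded g_def])
    \<comment> \<open>The root contributes \<open>1 powr p = 1\<close>, each of the other
      \<open>N\<close> generations \<open>2 powr p\<close>.\<close>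
    also have "{..N} = insert 0 {1..N}"
      by auto
    finally show ?thesis
      by simp
  qed
  have fsum: "(\<Sum>\<alpha>\<in>T. f \<alpha> powr p) = 2"
  proof -
    \<comment> \<open>The convention \<open>0 powr p = 0\<close> removes all vertices outside the
      support of \<open>f\<close>.\<close>
    have "(\<Sum>\<alpha>\<in>T. f \<alpha> powr p) = (\<Sum>n\<le>N. of_bool (n \<le> 1) powr p)"
      by (subst sumT) (simp_all add: f0 fJ)
    also have "\<dots> = (\<Sum>n\<in>{0, 1 :: nat}. 1)"
      using N1 by (intro sum.mono_neutral_cong_right) auto
    finally show ?thesis by simp
  qed
  have J0: "J 0 \<in> supp_on T g \<inter> supp_on T f"
    by (simp add: supp_on_def fJ gJ) (simp add: T_def J_def dyadic_interval_zero_in_tree)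
  have sup: "(SUP \<alpha>\<in>supp_on T g \<inter> supp_on T f. hardy T (hardy_adj T g) \<alpha>) \<le> 2 * real N + 1"
  proof (rule cSUP_least)
    show "supp_on T g \<inter> supp_on T f \<noteq> {}"
      using J0 by blast
    fix \<alpha> assume "\<alpha> \<in> supp_on T g \<inter> supp_on T f"
    \<comment> \<open>Every \<open>J n\<close> above \<open>\<alpha>\<close> then contains
      \<open>J 1\<close>, so only generations 0 and 1 enter \<open>II\<close>, with terms
      \<open>N + 1\<close> and \<open>N\<close>.\<close>
    then have "J 1 \<subseteq> \<alpha>"
      by (auto simp: supp_on_def f_def J_def dyadic_interval_zero)
    then have "n \<le> 1" if "\<alpha> \<subseteq> J n" for n
      using that dyadic_interval_zero_subset_iff[of 1 n] unfolding J_def by blast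
    then have "{n. n \<le> N \<and> \<alpha> \<subseteq> J n} \<subseteq> {0, 1}"
      by (fastforce simp: le_Suc_eq)
    then have "hardy T (hardy_adj T g) \<alpha> \<le> (\<Sum>n\<in>{0, 1}. real (N + 1 - n))"
      unfolding II by (intro sum_mono2) auto
    then show "hardy T (hardy_adj T g) \<alpha> \<le> 2 * real N + 1"
      by simp
  qed
  \<comment> \<open>All of \<open>J 0\<close>, ..., \<open>J N\<close> contain \<open>J N\<close>,
    so its sum in \<open>II\<close> runs over the largest possible index set, and the terms are
    nonnegative.\<close>
  have max: "hardy T (hardy_adj T g) \<alpha> \<le> hardy T (hardy_adj T g) (J N)" for \<alpha>
    unfolding II by (intro sum_mono2) (auto simp: J_def dyadic_interval_zero_subset_iff)
  have "J N \<in> leaves T" "J N \<in> supp_on T g"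
    by (simp_all add: supp_on_def gJ)
      (simp_all add: T_def J_def dyadic_interval_zero_in_leaves dyadic_interval_zero_in_tree)
  moreover have "superadditive T g"
    using superadditive_of_bool_zero by (simp add: T_def g_def)
  moreover have "tree_increasing T g"
    by (auto simp: tree_increasing_def g_def)
  moreover have "(SUP \<alpha>\<in>supp_on T g \<inter> supp_on T f. hardy T (hardy_adj T g) \<alpha>)
                  * (\<Sum>\<alpha>\<in>T. f \<alpha> powr p) < (\<Sum>\<alpha>\<in>T. (hardy T f \<alpha>) powr p * g \<alpha>)"
    unfolding lhs fsum using sup N by linarith
  moreover have "\<forall>\<alpha>\<in>T. 0 \<le> f \<alpha>" "\<forall>\<alpha>\<in>T. 0 \<le> g \<alpha>"
    by (simp_all add: f_def g_def)
  ultimately show ?thesis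
    using T_def J0 max
    by (intro exI[of _ N] exI[of _ f] exI[of _ g] exI[of _ T]) (auto simp: not_le)
qed

end
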